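(* For every integer $n\geq 3$ there exists an automorphism $\alpha$ of the free metabelian group $M_n$ of rank $n$ such that $\alpha$ acts trivially on the abelianization $M_n/[M_n,M_n]$ and the only fixed point of $\alpha$ is the identity, i.e., for $g\in M_n$, $\alpha(g)=g$ implies $g=1$.
   Context: Let $F_n$ be the free group on generators $g_1,\dots,g_n$, let $F_n'=[F_n,F_n]$ be its commutator subgroup and $F_n''=[F_n',F_n']$ its second commutator subgroup. The free metabelian group of rank $n$ is $M_n=F_n/F_n''$. *)

theory Defs
  imports "HOL-Algebra.Algebra"
begin

text \<open>
  The free group on a set of generators is realised by reduced words.  A letter
  \<open>(x, True)\<close> is the generator \<open>x\<close> and \<open>(x, False)\<close> is its formal inverse.
\<close>

definition inv_letter :: "'a \<times> bool \<Rightarrow> 'a \<times> bool" where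
  "inv_letter l = (fst l, \<not> snd l)"

definition reduced :: "('a \<times> bool) list \<Rightarrow> bool" where
  "reduced w \<longleftrightarrow> successively (\<lambda>l l'. l' \<noteq> inv_letter l) w"

fun push :: "'a \<times> bool \<Rightarrow> ('a \<times> bool) list \<Rightarrow> ('a \<times> bool) list" where
  "push l [] = [l]"
| "push l (l' # w) = (if l' = inv_letter l then w else l # l' # w)"

text \<open>
  For a reduced word \<open>v\<close>, the word \<open>foldr push u v\<close> is the reduced form of \<open>u @ v\<close>.
\<close>

definition free_group :: "'a set \<Rightarrow> ('a \<times> bool) list monoid" where
  "free_group S =
     \<lparr>carrier = {w \<in> lists (S \<times> UNIV). reduced w},
      monoid.mult = foldr push,
      one = []\<rparr>"

definition free_gen :: "'a \<Rightarrow> ('a \<times> bool) list" where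
  "free_gen x = [(x, True)]"

definition metabelian_quotient :: "('a, 'b) monoid_scheme \<Rightarrow> 'a set monoid" where
  "metabelian_quotient G = G Mod (derived G (derived G (carrier G)))"

definition free_metabelian_group :: "nat \<Rightarrow> (nat \<times> bool) list set monoid" where
  "free_metabelian_group n = metabelian_quotient (free_group {1..n})"

text \<open>
  An automorphism \<open>\<alpha>\<close> of \<open>G\<close> induces the map \<open>[G,G] g \<mapsto> [G,G] \<alpha>(g)\<close> on \<open>G/[G,G]\<close>;
  the following says that this map is the identity.
\<close>

definition trivial_on_abelianization :: "('a, 'b) monoid_scheme \<Rightarrow> ('a \<Rightarrow> 'a) \<Rightarrow> bool" where
  "trivial_on_abelianization G \<alpha> \<longleftrightarrow>
     (\<forall>g\<in>carrier G. derived G (carrier G) #>\<^bsub>G\<^esub> \<alpha> g = derived G (carrier G) #>\<^bsub>G\<^esub> g)"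

lemma inv_letter_inv_letter [simp]: "inv_letter (inv_letter l) = l"
  by (simp add: inv_letter_def)

lemma inv_letter_eq_iff: "inv_letter l = l' \<longleftrightarrow> l = inv_letter l'"
  by (auto simp: inv_letter_def)

lemma inv_letter_in [simp]: "inv_letter l \<in> S \<times> UNIV \<longleftrightarrow> l \<in> S \<times> UNIV"
  by (auto simp: inv_letter_def mem_Times_iff)

lemma reduced_Nil [simp]: "reduced []"
  by (simp add: reduced_def)

lemma reduced_Cons: "reduced (l # w) \<longleftrightarrow> reduced w \<and> (w = [] \<or> hd w \<noteq> inv_letter l)"
  by (auto simp: reduced_def successively_Cons)

lemma reduced_push: "reduced w \<Longrightarrow> reduced (push l w)"
  by (cases w) (auto simp: reduced_Cons)

lemma push_reduced: "reduced (l # w) \<Longrightarrow> push l w = l # w"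
  by (cases w) (auto simp: reduced_Cons)

lemma push_inv: "reduced w \<Longrightarrow> push l (push (inv_letter l) w) = w"
  by (cases w) (auto simp: push_reduced)

lemma reduced_foldr_push: "reduced v \<Longrightarrow> reduced (foldr push u v)"
  by (induction u) (auto simp: reduced_push)

lemma push_in_lists: "l \<in> A \<Longrightarrow> w \<in> lists A \<Longrightarrow> push l w \<in> lists A"
  by (cases w) auto

lemma foldr_push_in_lists: "u \<in> lists A \<Longrightarrow> v \<in> lists A \<Longrightarrow> foldr push u v \<in> lists A"
proof (induction u)
  case (Cons l u)
  then show ?case using push_in_lists[of l A "foldr push u v"] by simp
qed simp

lemma foldr_push_Nil: "reduced u \<Longrightarrow> foldr push u [] = u"
  by (induction u) (auto simp: push_reduced reduced_Cons)

lemma foldr_push_push: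
  assumes "reduced v"
  shows "foldr push (push l u) v = push l (foldr push u v)"
  by (cases u) (auto simp: push_inv reduced_foldr_push assms)

lemma foldr_push_assoc:
  assumes "reduced w"
  shows "foldr push (foldr push u v) w = foldr push u (foldr push v w)"
  by (induction u) (auto simp: foldr_push_push assms)

lemma foldr_push_rev_inv: "foldr push (rev (map inv_letter u)) u = []"
  by (induction u) auto

lemma reduced_rev_inv: "reduced u \<Longrightarrow> reduced (rev (map inv_letter u))"
  unfolding reduced_def successively_rev successively_map
  by (erule successively_mono) (auto simp: inv_letter_eq_iff)

lemma free_group_simps:
  "carrier (free_group S) = {w \<in> lists (S \<times> UNIV). reduced w}"
  "monoid.mult (free_group S) = foldr push"
  "one (free_group S) = []"
  by (simp_all add: free_group_def)

theorem group_free_group: "group (free_group S)"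
proof (rule groupI)
  fix x y assume "x \<in> carrier (free_group S)" "y \<in> carrier (free_group S)"
  then show "x \<otimes>\<^bsub>free_group S\<^esub> y \<in> carrier (free_group S)"
    using foldr_push_in_lists[of x "S \<times> UNIV" y] by (simp add: free_group_simps reduced_foldr_push)
next
  fix x assume x: "x \<in> carrier (free_group S)"
  let ?y = "rev (map inv_letter x)"
  have "?y \<in> carrier (free_group S)"
    using x by (fastforce simp: free_group_simps reduced_rev_inv inv_letter_def)
  moreover have "?y \<otimes>\<^bsub>free_group S\<^esub> x = \<one>\<^bsub>free_group S\<^esub>"
    by (simp only: free_group_simps foldr_push_rev_inv)
  ultimately show "\<exists>y\<in>carrier (free_group S). y \<otimes>\<^bsub>free_group S\<^esub> x = \<one>\<^bsub>free_group S\<^esub>"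
    by blast
qed (simp_all add: free_group_simps foldr_push_assoc)

lemma free_gen_closed: "x \<in> S \<Longrightarrow> free_gen x \<in> carrier (free_group S)"
  by (simp add: free_group_simps free_gen_def reduced_Cons)

definition eval_letter :: "('b, 'c) monoid_scheme \<Rightarrow> ('a \<Rightarrow> 'b) \<Rightarrow> 'a \<times> bool \<Rightarrow> 'b" where
  "eval_letter H f l = (if snd l then f (fst l) else inv\<^bsub>H\<^esub> f (fst l))"

definition eval_word :: "('b, 'c) monoid_scheme \<Rightarrow> ('a \<Rightarrow> 'b) \<Rightarrow> ('a \<times> bool) list \<Rightarrow> 'b" where
  "eval_word H f w = foldr (\<lambda>l y. eval_letter H f l \<otimes>\<^bsub>H\<^esub> y) w \<one>\<^bsub>H\<^esub>"

context
  fixes H :: "('b, 'c) monoid_scheme" (structure) and S :: "'a set" and f :: "'a \<Rightarrow> 'b"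
  assumes H: "group H" and f: "f \<in> S \<rightarrow> carrier H"
begin

interpretation group H by (rule H)

lemma eval_letter_closed: "l \<in> S \<times> UNIV \<Longrightarrow> eval_letter H f l \<in> carrier H"
  using f by (auto simp: eval_letter_def)

lemma eval_letter_inv:
  "l \<in> S \<times> UNIV \<Longrightarrow> eval_letter H f (inv_letter l) = inv (eval_letter H f l)"
  using f by (auto simp: eval_letter_def inv_letter_def Pi_iff)

lemma eval_word_closed: "w \<in> lists (S \<times> UNIV) \<Longrightarrow> eval_word H f w \<in> carrier H"
  by (induction w) (auto simp: eval_word_def eval_letter_closed)

lemma eval_word_push:
  assumes "l \<in> S \<times> UNIV" "w \<in> lists (S \<times> UNIV)"
  shows "eval_word H f (push l w) = eval_letter H f l \<otimes> eval_word H f w"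
proof (cases w)
  case (Cons l' v)
  show ?thesis
  proof (cases "l' = inv_letter l")
    case True
    have v: "eval_word H f v \<in> carrier H" and l: "eval_letter H f l \<in> carrier H"
      using assms Cons by (auto intro: eval_word_closed eval_letter_closed)
    have "eval_word H f w = inv (eval_letter H f l) \<otimes> eval_word H f v"
      using Cons True eval_letter_inv[OF assms(1)] by (simp add: eval_word_def)
    then show ?thesis using v l Cons True by (simp add: m_assoc[symmetric])
  qed (simp add: Cons eval_word_def)
qed (simp add: eval_word_def)

lemma eval_word_foldr_push:
  assumes "v \<in> lists (S \<times> UNIV)"
  shows "u \<in> lists (S \<times> UNIV) \<Longrightarrow>
    eval_word H f (foldr push u v) = eval_word H f u \<otimes> eval_word H f v"
proof (induction u)
  case Nil
  then show ?case using eval_word_closed[OF assms] by (simp add: eval_word_def)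
next
  case (Cons l u)
  have l: "l \<in> S \<times> UNIV" and u: "u \<in> lists (S \<times> UNIV)" using Cons.prems by auto
  have "eval_word H f (foldr push (l # u) v) = eval_letter H f l \<otimes> eval_word H f (foldr push u v)"
    using eval_word_push[OF l foldr_push_in_lists[OF u assms]] by simp
  also have "\<dots> = eval_letter H f l \<otimes> eval_word H f u \<otimes> eval_word H f v"
    using Cons.IH[OF u] eval_letter_closed[OF l] eval_word_closed[OF u] eval_word_closed[OF assms]
    by (simp add: m_assoc)
  finally show ?case by (simp add: eval_word_def)
qed

lemma eval_word_hom: "eval_word H f \<in> hom (free_group S) H"
  by (rule homI) (auto simp: free_group_simps intro: eval_word_closed eval_word_foldr_push)

lemma eval_word_free_gen: "x \<in> S \<Longrightarrow> eval_word H f (free_gen x) = f x"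
  using f by (auto simp: eval_word_def eval_letter_def free_gen_def Pi_iff)

lemma eval_word_unique:
  assumes h: "h \<in> hom (free_group S) H" and hf: "\<And>x. x \<in> S \<Longrightarrow> h (free_gen x) = f x"
    and w: "w \<in> carrier (free_group S)"
  shows "h w = eval_word H f w"
  using w
proof (induction w)
  case Nil
  then show ?case
    using hom_one[OF h group_free_group H] by (simp add: free_group_simps eval_word_def)
next
  case (Cons l w)
  let ?F = "free_group S"
  interpret F: group ?F by (rule group_free_group)
  interpret h: group_hom ?F H h by unfold_locales (rule h)
  have w: "w \<in> carrier ?F" and l: "[l] \<in> carrier ?F" and ls: "fst l \<in> S"
    using Cons.prems by (auto simp: free_group_simps reduced_Cons)
  have "l # w = [l] \<otimes>\<^bsub>?F\<^esub> w"
    using Cons.prems by (simp add: free_group_simps push_reduced)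
  then have "h (l # w) = h [l] \<otimes> eval_word H f w"
    using Cons.IH w l by (simp add: h.hom_mult)
  also have "h [l] = eval_letter H f l"
  proof (cases "snd l")
    case True
    then show ?thesis using hf[OF ls] by (simp add: free_gen_def eval_letter_def prod_eq_iff)
        (metis prod.collapse)
  next
    case False
    have "[l] \<otimes>\<^bsub>?F\<^esub> free_gen (fst l) = \<one>\<^bsub>?F\<^esub>"
      using False by (simp add: free_group_simps free_gen_def inv_letter_def)
    then have "[l] = inv\<^bsub>?F\<^esub> free_gen (fst l)"
      using F.inv_equality[of "[l]" "free_gen (fst l)"] l free_gen_closed[OF ls] by simp
    then have "h [l] = inv h (free_gen (fst l))"
      using free_gen_closed[OF ls] by (simp add: h.hom_inv)
    then show ?thesis using False hf[OF ls] by (simp add: eval_letter_def)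
  qed
  finally show ?case by (simp add: eval_word_def)
qed

theorem free_group_universal:
  "\<exists>!h. h \<in> extensional (carrier (free_group S)) \<and> h \<in> hom (free_group S) H
      \<and> (\<forall>x\<in>S. h (free_gen x) = f x)"
proof (rule ex1I)
  let ?h = "restrict (eval_word H f) (carrier (free_group S))"
  have "?h \<in> hom (free_group S) H"
    using eval_word_hom group.subgroup_self[OF group_free_group, of S]
    by (auto simp: hom_def Pi_iff subgroup.m_closed)
  then show "?h \<in> extensional (carrier (free_group S)) \<and> ?h \<in> hom (free_group S) H
      \<and> (\<forall>x\<in>S. ?h (free_gen x) = f x)"
    by (simp add: eval_word_free_gen free_gen_closed)
next
  fix h assume h: "h \<in> extensional (carrier (free_group S)) \<and> h \<in> hom (free_group S) H
      \<and> (\<forall>x\<in>S. h (free_gen x) = f x)"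
  show "h = restrict (eval_word H f) (carrier (free_group S))"
    using h eval_word_unique[of h] by (intro extensionalityI[of _ "carrier (free_group S)"]) auto
qed

end

lemma normal_derived_derived:
  assumes "group G"
  shows "derived G (derived G (carrier G)) \<lhd> G"
proof -
  interpret group G by (rule assms)
  show ?thesis
    by (intro derived_is_normal normal_self)
qed

lemma group_free_metabelian_group: "group (free_metabelian_group n)"
  unfolding free_metabelian_group_def metabelian_quotient_def
  by (intro normal.factorgroup_is_group normal_derived_derived group_free_group)

end

theory Submission
  imports Defs
    "HOL-Computational_Algebra.Formal_Power_Series"
    "HOL-Computational_Algebra.Primes"
begin

text \<open>
  Partial conjugations \<open>g\<^sub>i \<mapsto> g\<^sub>k g\<^sub>i g\<^sub>k\<inverse>\<close> are automorphisms of the free group; the required automorphism is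
  induced by their product over the cyclic pairs \<open>k = i + 1 (mod n)\<close>.

  The Fox derivatives embed the free metabelian group into \<open>R\<^sup>n \<rtimes> \<int>\<^sup>n\<close>, where \<open>R\<close> is the ring of
  Laurent polynomials, and \<open>R\<close> embeds into the real power series in \<open>s\<close> by \<open>x\<^sub>i \<mapsto> exp (t\<^sub>i s)\<close>
  for positive reals \<open>t\<^sub>i\<close> linearly independent over the rationals (logarithms of primes).
  The product of the partial conjugations acts on the vector \<open>v\<close> of Fox derivatives, and comparing the
  lowest coefficients \<open>v\<^sub>i\<close> of a fixed vector gives \<open>v\<^sub>i t\<^sub>i t\<^sub>i\<^sub>+\<^sub>1 = q\<close> with \<open>q\<close> independent of \<open>i\<close>.
  At order zero the \<open>v\<^sub>i\<close> are the exponent sums, which are integers, so \<open>v\<^sub>1 t\<^sub>1 = v\<^sub>2 t\<^sub>3\<close> forces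
  \<open>q = 0\<close> and a fixed element lies in the commutator subgroup.  There the fundamental formula
  \<open>\<Sum> v\<^sub>i (x\<^sub>i - 1) = 0\<close> becomes \<open>\<Sum> v\<^sub>i t\<^sub>i = q \<Sum> 1 / t\<^sub>i\<^sub>+\<^sub>1 = 0\<close> at lowest order, so \<open>q = 0\<close>
  again and \<open>v\<close> vanishes.
\<close>

declare One_nat_def [simp del]

section \<open>Independence of exponentials and of logarithms of primes\<close>

text \<open>A Vandermonde argument: subtracting \<open>d\<close> times the relation for
  \<open>k\<close> from the one for \<open>k + 1\<close> removes the node \<open>d\<close> and
  rescales every other coefficient by the nonzero factor \<open>c - d\<close>.\<close>

lemma sum_mult_powers_eq_0D:
  fixes a :: "'a :: idom \<Rightarrow> 'a"
  assumes "finite E" "\<And>k. (\<Sum>c\<in>E. a c * c ^ k) = 0" "c \<in> E"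
  shows "a c = 0"
  using assms
proof (induction E arbitrary: a c rule: finite_induct)
  case (insert d E)
  have "(\<Sum>c\<in>E. (a c * (c - d)) * c ^ k) = 0" for k
  proof -
    have "(\<Sum>c\<in>insert d E. a c * c ^ Suc k) - d * (\<Sum>c\<in>insert d E. a c * c ^ k) = 0"
      using insert.prems(1) by (simp del: power_Suc)
    moreover have "(\<Sum>c\<in>insert d E. a c * c ^ Suc k) - d * (\<Sum>c\<in>insert d E. a c * c ^ k)
       = (\<Sum>c\<in>insert d E. (a c * (c - d)) * c ^ k)"
      unfolding sum_distrib_left sum_subtractf[symmetric]
      by (intro sum.cong refl) (simp add: algebra_simps)
    ultimately show ?thesis using insert.hyps by simp
  qed
  then have *: "a c = 0" if "c \<in> E" for c
    using insert.IH[of "\<lambda>c. a c * (c - d)" c] that insert.hyps by auto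
  then have "a d = 0"
    using insert.prems(1)[of 0] insert.hyps by simp
  with * insert.prems(2) show ?case by auto
qed auto

lemma fps_exp_independent:
  fixes a :: "real \<Rightarrow> int"
  assumes "finite E" "(\<Sum>c\<in>E. of_int (a c) * fps_exp c) = 0" "c \<in> E"
  shows "a c = 0"
proof -
  have "(\<Sum>c\<in>E. of_int (a c) * c ^ k) = 0" for k
  proof -
    have "0 = fps_nth (\<Sum>c\<in>E. of_int (a c) * fps_exp c) k"
      using assms(2) by simp
    also have "\<dots> = (\<Sum>c\<in>E. of_int (a c) * c ^ k) / fact k"
      by (simp add: fps_sum_nth sum_divide_distrib fps_of_int[symmetric] fps_mult_left_const_nth)
    finally show ?thesis by simp
  qed
  from sum_mult_powers_eq_0D[OF assms(1) this assms(3)] show ?thesis by simp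
qed

text \<open>Moving the negative terms to the other side and exponentiating gives two equal products
  of prime powers; unique factorization compares them.\<close>

lemma ln_primes_independent:
  fixes p :: "'i \<Rightarrow> nat" and a :: "'i \<Rightarrow> int"
  assumes I: "finite I" "inj_on p I" and prime: "\<And>i. i \<in> I \<Longrightarrow> Factorial_Ring.prime (p i)"
    and 0: "(\<Sum>i\<in>I. of_int (a i) * ln (real (p i))) = 0" and j: "j \<in> I"
  shows "a j = 0"
proof -
  \<comment> \<open>Because \<open>nat\<close> truncates negative integers to 0, the identity
    collects the positive exponents and \<open>uminus\<close> the negative ones.\<close>
  define b where "b f = (\<Prod>i\<in>I. p i ^ nat (f (a i)))" for f :: "int \<Rightarrow> int"
  have ln_b: "ln (real (b f)) = (\<Sum>i\<in>I. real (nat (f (a i))) * ln (real (p i)))" for f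
    using I prime by (simp add: b_def ln_prod ln_realpow prime_gt_0_nat)
  have "ln (real (b (\<lambda>x. x))) - ln (real (b uminus)) = (\<Sum>i\<in>I. of_int (a i) * ln (real (p i)))"
    unfolding ln_b sum_subtractf[symmetric] left_diff_distrib[symmetric]
    by (intro sum.cong refl) auto
  moreover have pos: "b f > 0" for f
    using prime by (auto simp: b_def prime_gt_0_nat intro!: prod_pos)
  ultimately have eq: "b (\<lambda>x. x) = b uminus"
    using 0 by simp
  have mult: "multiplicity (p j) (b f) = nat (f (a j))" for f
  proof -
    have b_eq: "b f = (\<Prod>q\<in>p ` I. q ^ nat (f (a (inv_into I p q))))"
      unfolding b_def using I by (subst prod.reindex) auto
    then show ?thesis
      using I prime j
      unfolding b_eq by (subst multiplicity_prod_prime_powers) auto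
  qed
  show ?thesis
    using mult[of "\<lambda>x. x"] mult[of uminus] eq by simp
qed

section \<open>Words with vanishing exponent sums\<close>

definition exponent_sum :: "'a \<Rightarrow> ('a \<times> bool) list \<Rightarrow> int" where
  "exponent_sum x w = (\<Sum>l\<leftarrow>w. if fst l = x then if snd l then 1 else -1 else 0)"

lemma exponent_sum_simps [simp]:
  "exponent_sum x [] = 0"
  "exponent_sum x (l # w) = (if fst l = x then if snd l then 1 else -1 else 0) + exponent_sum x w"
  by (simp_all add: exponent_sum_def)

lemma eval_word_simps [simp]:
  "eval_word H f [] = \<one>\<^bsub>H\<^esub>"
  "eval_word H f (l # w) = eval_letter H f l \<otimes>\<^bsub>H\<^esub> eval_word H f w"
  by (simp_all add: eval_word_def)

lemma (in comm_group) eval_word_eq_finprod: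
  assumes f: "f \<in> E \<rightarrow> carrier G" and E: "finite E"
  shows "w \<in> lists (E \<times> UNIV) \<Longrightarrow> eval_word G f w = (\<Otimes>x\<in>E. f x [^] exponent_sum x w)"
proof (induction w)
  case Nil
  show ?case using f by (simp add: Pi_iff finprod_one_eqI)
next
  case (Cons l w)
  have l: "fst l \<in> E" using Cons.prems by auto
  have fx: "f x \<in> carrier G" if "x \<in> E" for x using f that by auto
  have "eval_letter G f l = (\<Otimes>x\<in>E. if fst l = x then f x [^] (if snd l then 1 else -1 :: int) else \<one>)"
    using l E fx by (subst finprod_singleton) (auto simp: eval_letter_def int_pow_neg)
  also have "\<dots> = (\<Otimes>x\<in>E. f x [^] (if fst l = x then if snd l then 1 else -1 else 0 :: int))"
    using fx by (intro finprod_cong') (auto)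
  finally have "eval_word G f (l # w) =
      (\<Otimes>x\<in>E. f x [^] (if fst l = x then if snd l then 1 else -1 else 0 :: int)) \<otimes>
      (\<Otimes>x\<in>E. f x [^] exponent_sum x w)"
    using Cons by simp
  also have "\<dots> = (\<Otimes>x\<in>E. f x [^] exponent_sum x (l # w))"
  proof -
    have "f x [^] exponent_sum x (l # w) =
        f x [^] (if fst l = x then if snd l then 1 else -1 else 0 :: int) \<otimes> f x [^] exponent_sum x w"
      if "x \<in> E" for x
      using fx[OF that] unfolding exponent_sum_simps by (rule int_pow_mult)
    then have "(\<Otimes>x\<in>E. f x [^] exponent_sum x (l # w)) = (\<Otimes>x\<in>E.
        f x [^] (if fst l = x then if snd l then 1 else -1 else 0 :: int) \<otimes> f x [^] exponent_sum x w)"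
      using fx by (intro finprod_cong') auto
    then show ?thesis
      using fx by (simp add: finprod_multf)
  qed
  finally show ?case .
qed

lemma (in group_hom) hom_eval_word:
  assumes f: "f \<in> E \<rightarrow> carrier G" and w: "w \<in> lists (E \<times> UNIV)"
  shows "h (eval_word G f w) = eval_word H (\<lambda>x. h (f x)) w"
  using w
proof (induction w)
  case (Cons l w)
  then have "fst l \<in> E" by auto
  then have "f (fst l) \<in> carrier G" using f by auto
  then have "h (eval_letter G f l) = eval_letter H (\<lambda>x. h (f x)) l"
    by (simp add: eval_letter_def)
  moreover have "eval_letter G f l \<in> carrier G" "eval_word G f w \<in> carrier G"
    using Cons eval_letter_closed[OF G.is_group f] eval_word_closed[OF G.is_group f] by auto
  ultimately show ?case using Cons by simp
qed simp

text \<open>In the quotient by the commutator subgroup the letters commute, so the word collects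
  into powers with exponent 0.\<close>

lemma (in group) eval_word_in_derived:
  assumes f: "f \<in> E \<rightarrow> carrier G" and w: "w \<in> lists (E \<times> UNIV)"
    and 0: "\<And>x. exponent_sum x w = 0"
  shows "eval_word G f w \<in> derived G (carrier G)"
proof -
  let ?D = "derived G (carrier G)"
  let ?Q = "G Mod ?D"
  let ?h = "\<lambda>x. ?D #> x"
  let ?Y = "fst ` set w"
  interpret D: normal ?D G by (rule derived_self_is_normal)
  interpret Q: comm_group ?Q by (rule derived_quot_is_comm_group)
  interpret h: group_hom G ?Q ?h
    by unfold_locales (rule D.r_coset_hom_Mod)
  have YE: "?Y \<subseteq> E" and wY: "w \<in> lists (?Y \<times> UNIV)" using w by (force simp: mem_Times_iff)+
  have hf: "(\<lambda>x. ?h (f x)) \<in> ?Y \<rightarrow> carrier ?Q" using f YE h.hom_closed by blast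
  have "?h (eval_word G f w) = eval_word ?Q (\<lambda>x. ?h (f x)) w"
    using h.hom_eval_word[OF f w] .
  also have "\<dots> = \<one>\<^bsub>?Q\<^esub>"
    using Q.eval_word_eq_finprod[OF hf _ wY] 0 by (simp add: Q.finprod_one_eqI)
  finally have "?h (eval_word G f w) = ?D" by simp
  then show ?thesis
    using rcos_self[OF eval_word_closed[OF is_group f w] D.subgroup_axioms] by simp
qed

section \<open>The Magnus representation\<close>

text \<open>
  By the independence of the \<open>t\<^sub>i\<close>, an element of \<open>\<int>\<^sup>n\<close> is encoded by the real number \<open>\<Sum> a\<^sub>i t\<^sub>i\<close>,
  its weight.
\<close>

definition magnus_group :: "(real \<times> (nat \<Rightarrow> real fps)) monoid" where
  "magnus_group = \<lparr>carrier = UNIV,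
     monoid.mult = (\<lambda>x y. (fst x + fst y, \<lambda>j. snd x j + fps_exp (fst x) * snd y j)),
     one = (0, \<lambda>_. 0)\<rparr>"

lemma magnus_group_simps [simp]:
  "carrier magnus_group = UNIV"
  "x \<otimes>\<^bsub>magnus_group\<^esub> y = (fst x + fst y, \<lambda>j. snd x j + fps_exp (fst x) * snd y j)"
  "\<one>\<^bsub>magnus_group\<^esub> = (0, \<lambda>_. 0)"
  by (simp_all add: magnus_group_def)

lemma group_magnus_group: "group magnus_group"
proof (rule groupI)
  fix x :: "real \<times> (nat \<Rightarrow> real fps)"
  have "(- fst x, \<lambda>j. - fps_exp (- fst x) * snd x j) \<otimes>\<^bsub>magnus_group\<^esub> x = \<one>\<^bsub>magnus_group\<^esub>"
    by (simp add: mult.assoc[symmetric] fps_exp_add_mult[symmetric])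
  then show "\<exists>y\<in>carrier magnus_group. y \<otimes>\<^bsub>magnus_group\<^esub> x = \<one>\<^bsub>magnus_group\<^esub>"
    by (rule bexI) simp
qed (auto simp: fps_exp_add_mult algebra_simps)

lemma inv_magnus_group:
  "inv\<^bsub>magnus_group\<^esub> x = (- fst x, \<lambda>j. - fps_exp (- fst x) * snd x j)"
  by (rule group.inv_equality[OF group_magnus_group]) auto

text \<open>Weights add, so commutators have weight 0; there the twist \<open>fps_exp 0\<close> is
  1, so elements of weight 0 commute.\<close>

lemma derived_derived_magnus_group:
  "derived magnus_group (derived magnus_group (carrier magnus_group)) \<subseteq> {\<one>\<^bsub>magnus_group\<^esub>}"
proof -
  interpret H: group magnus_group by (rule group_magnus_group)
  define T :: "(real \<times> (nat \<Rightarrow> real fps)) set" where "T = {x. fst x = 0}"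
  have T: "subgroup T magnus_group"
    by (rule H.subgroupI) (auto simp: T_def inv_magnus_group)
  have 1: "derived_set magnus_group (carrier magnus_group) \<subseteq> T"
    by (auto simp: T_def inv_magnus_group)
  have 2: "derived_set magnus_group T \<subseteq> {\<one>\<^bsub>magnus_group\<^esub>}"
    by (auto simp: T_def inv_magnus_group)
  have "derived magnus_group (carrier magnus_group) \<subseteq> T"
    unfolding derived_def by (rule H.generate_subgroup_incl[OF 1 T])
  from H.mono_derived[OF this] have
    "derived magnus_group (derived magnus_group (carrier magnus_group)) \<subseteq> derived magnus_group T" .
  also have "\<dots> \<subseteq> {\<one>\<^bsub>magnus_group\<^esub>}"
    unfolding derived_def by (rule H.generate_subgroup_incl[OF 2 H.triv_subgroup])
  finally show ?thesis .
qed

lemma eval_word_free_group: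
  assumes "w \<in> carrier (free_group S)"
  shows "eval_word (free_group S) free_gen w = w"
  using eval_word_unique[OF group_free_group, of free_gen S S "\<lambda>w. w" w] assms
  by (auto simp: free_gen_closed hom_def)

text \<open>Independence lets a weight determine all exponent sums; positivity allows division by
  \<open>t i\<close> and excludes cancellation in a sum of reciprocals.\<close>

locale magnus =
  fixes n :: nat and t :: "nat \<Rightarrow> real"
  assumes t_pos: "i \<in> {1..n} \<Longrightarrow> t i > 0"
    and t_indep: "(\<Sum>i=1..n. of_int (a i) * t i) = 0 \<Longrightarrow> i \<in> {1..n} \<Longrightarrow> a i = (0 :: int)"
begin

abbreviation F :: "(nat \<times> bool) list monoid" where "F \<equiv> free_group {1..n}"

abbreviation D :: "(nat \<times> bool) list set" where "D \<equiv> derived F (carrier F)"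

sublocale F: group F by (rule group_free_group)

sublocale H: group magnus_group by (rule group_magnus_group)

definition mu :: "(nat \<times> bool) list \<Rightarrow> real \<times> (nat \<Rightarrow> real fps)" where
  "mu = eval_word magnus_group (\<lambda>i. (t i, \<lambda>j. if j = i then 1 else 0))"

definition weight :: "(nat \<times> bool) list \<Rightarrow> real" where
  "weight w = fst (mu w)"

text \<open>Multiplication in \<open>magnus_group\<close> is the Leibniz rule of Fox calculus, so
  this is the vector of Fox derivatives with \<open>x_i\<close> replaced by
  \<open>fps_exp (t i)\<close>.\<close>

definition fox :: "(nat \<times> bool) list \<Rightarrow> nat \<Rightarrow> real fps" where
  "fox w = snd (mu w)"

lemma mu_eq: "mu w = (weight w, fox w)"
  by (simp add: weight_def fox_def)

lemma mu_hom: "mu \<in> hom F magnus_group"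
  unfolding mu_def by (rule eval_word_hom[OF group_magnus_group]) simp

sublocale mu: group_hom F magnus_group mu
  by unfold_locales (rule mu_hom)

lemma weight_simps [simp]:
  "weight [] = 0"
  "weight ((i, b) # w) = (if b then t i else - t i) + weight w"
  by (auto simp: weight_def mu_def eval_letter_def inv_magnus_group)

lemma fox_simps [simp]:
  "fox [] j = 0"
  "fox ((i, True) # w) j = (if j = i then 1 else 0) + fps_exp (t i) * fox w j"
  "fox ((i, False) # w) j = fps_exp (- t i) * (fox w j - (if j = i then 1 else 0))"
  by (auto simp: fox_def mu_def eval_letter_def inv_magnus_group algebra_simps)

lemma weight_mult: "u \<in> carrier F \<Longrightarrow> w \<in> carrier F \<Longrightarrow> weight (u \<otimes>\<^bsub>F\<^esub> w) = weight u + weight w"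
  by (simp add: weight_def)

lemma fox_mult:
  "u \<in> carrier F \<Longrightarrow> w \<in> carrier F \<Longrightarrow> fox (u \<otimes>\<^bsub>F\<^esub> w) j = fox u j + fps_exp (weight u) * fox w j"
  by (simp add: fox_def weight_def)

lemma weight_inv: "u \<in> carrier F \<Longrightarrow> weight (inv\<^bsub>F\<^esub> u) = - weight u"
  by (simp add: weight_def inv_magnus_group)

lemma fox_inv: "u \<in> carrier F \<Longrightarrow> fox (inv\<^bsub>F\<^esub> u) j = - fps_exp (- weight u) * fox u j"
  by (simp add: weight_def fox_def inv_magnus_group)

lemma weight_free_gen [simp]: "weight (free_gen i) = t i"
  by (simp add: free_gen_def)

lemma fox_free_gen [simp]: "fox (free_gen i) j = (if j = i then 1 else 0)"
  by (simp add: free_gen_def)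

lemma weight_eq_sum:
  "w \<in> lists ({1..n} \<times> UNIV) \<Longrightarrow> weight w = (\<Sum>i=1..n. of_int (exponent_sum i w) * t i)"
proof (induction w)
  case (Cons l w)
  obtain i b where l: "l = (i, b)" by fastforce
  have "(\<Sum>j=1..n. of_int (exponent_sum j (l # w)) * t j) =
      (\<Sum>j=1..n. (if i = j then if b then t i else - t i else 0)
        + of_int (exponent_sum j w) * t j)"
    by (intro sum.cong) (auto simp: l algebra_simps)
  then show ?case
    using Cons by (simp add: l sum.distrib)
qed simp

lemma exponent_sum_outside:
  "w \<in> lists (A \<times> UNIV) \<Longrightarrow> i \<notin> A \<Longrightarrow> exponent_sum i w = 0"
  by (induction w) auto

lemma exponent_sum_eq_0:
  assumes "w \<in> lists ({1..n} \<times> UNIV)" "weight w = 0"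
  shows "exponent_sum i w = 0"
  using t_indep[of "\<lambda>i. exponent_sum i w" i] weight_eq_sum[OF assms(1)] assms
    exponent_sum_outside[OF assms(1), of i] by auto

text \<open>Setting the series variable to 0 is augmentation: every group element becomes 1 and only
  the signs of the letters are counted.\<close>

lemma fox_nth_0: "fps_nth (fox w j) 0 = of_int (exponent_sum j w)"
proof (induction w)
  case (Cons l w)
  obtain i b where l: "l = (i, b)" by fastforce
  show ?case using Cons by (cases b) (auto simp: l)
qed simp

text \<open>Both sides obey the same Leibniz rule and agree on the generators; the induction checks
  this letter by letter.\<close>

lemma fox_fundamental:
  "w \<in> lists ({1..n} \<times> UNIV) \<Longrightarrow> (\<Sum>i=1..n. fox w i * (fps_exp (t i) - 1)) = fps_exp (weight w) - 1"
proof (induction w)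
  case (Cons l w)
  obtain i b where l: "l = (i, b)" by fastforce
  then have i: "i \<in> {1..n}" and IH: "(\<Sum>i=1..n. fox w i * (fps_exp (t i) - 1)) = fps_exp (weight w) - 1"
    using Cons by auto
  show ?case
  proof (cases b)
    case True
    have "(\<Sum>j=1..n. fox (l # w) j * (fps_exp (t j) - 1)) =
       (\<Sum>j=1..n. (if i = j then fps_exp (t i) - 1 else 0)
          + fps_exp (t i) * (fox w j * (fps_exp (t j) - 1)))"
      by (intro sum.cong) (auto simp: l True algebra_simps)
    also have "\<dots> = (fps_exp (t i) - 1) + fps_exp (t i) * (fps_exp (weight w) - 1)"
      using i IH by (simp add: sum.distrib sum_distrib_left[symmetric])
    finally show ?thesis by (simp add: l True fps_exp_add_mult algebra_simps)
  next
    case False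
    have "(\<Sum>j=1..n. fox (l # w) j * (fps_exp (t j) - 1)) =
       (\<Sum>j=1..n. (if i = j then - fps_exp (- t i) * (fps_exp (t i) - 1) else 0)
          + fps_exp (- t i) * (fox w j * (fps_exp (t j) - 1)))"
      by (intro sum.cong) (auto simp: l False algebra_simps)
    also have "\<dots> = - fps_exp (- t i) * (fps_exp (t i) - 1) + fps_exp (- t i) * (fps_exp (weight w) - 1)"
      using i IH by (simp add: sum.distrib sum_distrib_left[symmetric])
    also have "\<dots> = fps_exp (- t i) * fps_exp (weight w) - fps_exp (- t i) * fps_exp (t i)"
      by (simp add: algebra_simps)
    finally show ?thesis by (simp add: l False fps_exp_add_mult[symmetric])
  qed
qed simp

lemma in_derived_if_weight_eq_0:
  assumes w: "w \<in> carrier F" and "weight w = 0"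
  shows "w \<in> D"
proof -
  have wl: "w \<in> lists ({1..n} \<times> UNIV)" using w by (simp add: free_group_simps)
  have "eval_word F free_gen w \<in> D"
    using exponent_sum_eq_0[OF wl assms(2)] wl
    by (intro F.eval_word_in_derived[of _ "{1..n}"]) (auto intro: free_gen_closed)
  then show ?thesis by (simp add: eval_word_free_group w)
qed

section \<open>Schreier rewriting along paths in the Cayley graph\<close>

text \<open>
  A word is read as a path in the Cayley graph of the abelianization, whose vertices are encoded by
  their weights; \<open>(c, i)\<close> is the edge leaving \<open>c\<close> in direction \<open>i\<close>.
\<close>

fun path :: "real \<Rightarrow> (nat \<times> bool) list \<Rightarrow> ((real \<times> nat) \<times> bool) list" where
  "path c [] = []"
| "path c ((i, b) # w) = (if b then ((c, i), True) # path (c + t i) w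
     else ((c - t i, i), False) # path (c - t i) w)"

text \<open>The coefficient of \<open>fps_exp d\<close> counts the signed traversals of the edge
  \<open>(d, j)\<close>. Allowing any finite \<open>A\<close> that covers the tails of the edges
  keeps \<open>A\<close> fixed during the induction.\<close>

lemma fox_eq_path_sum:
  assumes "finite A"
  shows "fst ` fst ` set (path c w) \<subseteq> A \<Longrightarrow>
    fps_exp c * fox w j = (\<Sum>d\<in>A. of_int (exponent_sum (d, j) (path c w)) * fps_exp d)"
proof (induction c w rule: path.induct)
  case (2 c i b w)
  show ?case
  proof (cases b)
    case True
    then have IH: "fps_exp (c + t i) * fox w j =
        (\<Sum>d\<in>A. of_int (exponent_sum (d, j) (path (c + t i) w)) * fps_exp d)"
      and c: "c \<in> A"
      using 2 by auto
    have "(\<Sum>d\<in>A. of_int (exponent_sum (d, j) (path c ((i, b) # w))) * fps_exp d) =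
       (\<Sum>d\<in>A. (if c = d then (if j = i then fps_exp c else 0) else 0)
         + of_int (exponent_sum (d, j) (path (c + t i) w)) * fps_exp d)"
      by (intro sum.cong) (auto simp: True algebra_simps)
    also have "\<dots> = (if j = i then fps_exp c else 0) + fps_exp (c + t i) * fox w j"
      using c assms by (simp add: sum.distrib IH)
    finally show ?thesis by (simp add: True fps_exp_add_mult algebra_simps)
  next
    case False
    then have IH: "fps_exp (c - t i) * fox w j =
        (\<Sum>d\<in>A. of_int (exponent_sum (d, j) (path (c - t i) w)) * fps_exp d)"
      and c: "c - t i \<in> A"
      using 2 by auto
    have "(\<Sum>d\<in>A. of_int (exponent_sum (d, j) (path c ((i, b) # w))) * fps_exp d) =
       (\<Sum>d\<in>A. (if c - t i = d then (if j = i then - fps_exp (c - t i) else 0) else 0)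
         + of_int (exponent_sum (d, j) (path (c - t i) w)) * fps_exp d)"
      by (intro sum.cong) (auto simp: False algebra_simps)
    also have "\<dots> = (if j = i then - fps_exp (c - t i) else 0) + fps_exp (c - t i) * fox w j"
      using c assms by (simp add: sum.distrib IH)
    finally show ?thesis
      using fps_exp_add_mult[of c "- t i"] by (simp add: False algebra_simps)
  qed
qed simp

lemma exponent_sum_path:
  assumes "\<And>j. fox w j = 0"
  shows "exponent_sum e (path c w) = 0"
proof -
  obtain d j where e: "e = (d, j)" by fastforce
  \<comment> \<open>Inserting \<open>d\<close> makes its coefficient occur in the sum even if the
    path uses no edge leaving \<open>d\<close>; independence of exponentials then kills it.\<close>
  let ?A = "insert d (fst ` fst ` set (path c w))"
  have "(\<Sum>d\<in>?A. of_int (exponent_sum (d, j) (path c w)) * fps_exp d) = 0"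
    using fox_eq_path_sum[of ?A c w j] assms by auto
  from fps_exp_independent[OF _ this, of d] show ?thesis by (simp add: e)
qed

text \<open>Coset representatives of \<open>D\<close> in \<open>F\<close>, a coset being determined
  by its weight. The empty word at 0 makes a closed path at 0 leave no boundary factors.\<close>

definition transversal :: "real \<Rightarrow> (nat \<times> bool) list" where
  "transversal c = (if c = 0 then [] else SOME w. w \<in> carrier F \<and> weight w = c)"

lemma transversal:
  assumes "c \<in> weight ` carrier F"
  shows "transversal c \<in> carrier F" "weight (transversal c) = c"
proof -
  have "\<exists>w. w \<in> carrier F \<and> weight w = c" using assms by auto
  from someI_ex[OF this] show "transversal c \<in> carrier F" "weight (transversal c) = c"
    by (auto simp: transversal_def free_group_simps)
qed

text \<open>The Schreier generator of \<open>D\<close> attached to an edge.\<close>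

definition edge_word :: "real \<times> nat \<Rightarrow> (nat \<times> bool) list" where
  "edge_word e = transversal (fst e) \<otimes>\<^bsub>F\<^esub> free_gen (snd e)
     \<otimes>\<^bsub>F\<^esub> inv\<^bsub>F\<^esub> transversal (fst e + t (snd e))"

lemma weight_image_step:
  assumes "c \<in> weight ` carrier F" "i \<in> {1..n}"
  shows "c + t i \<in> weight ` carrier F" "c - t i \<in> weight ` carrier F"
proof -
  obtain w where w: "w \<in> carrier F" "c = weight w" using assms by auto
  have g: "free_gen i \<in> carrier F" using assms by (intro free_gen_closed)
  have "weight (w \<otimes>\<^bsub>F\<^esub> free_gen i) = c + t i" "weight (w \<otimes>\<^bsub>F\<^esub> inv\<^bsub>F\<^esub> free_gen i) = c - t i"
    using w g by (simp_all add: weight_mult weight_inv)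
  then show "c + t i \<in> weight ` carrier F" "c - t i \<in> weight ` carrier F"
    using w g by (metis F.m_closed F.inv_closed imageI)+
qed

lemma weight_image_add:
  assumes "c \<in> weight ` carrier F" "w \<in> lists ({1..n} \<times> UNIV)"
  shows "c + weight w \<in> weight ` carrier F"
  using assms
proof (induction c w rule: path.induct)
  case (2 c i b w)
  then show ?case using weight_image_step[of c i] by (cases b) (auto simp: algebra_simps)
qed simp

lemma edge_word_in_derived:
  assumes "c \<in> weight ` carrier F" "i \<in> {1..n}"
  shows "edge_word (c, i) \<in> D"
proof (rule in_derived_if_weight_eq_0)
  note [simp] = transversal[OF assms(1)] transversal[OF weight_image_step(1)[OF assms]]
    free_gen_closed[OF assms(2)]
  show "edge_word (c, i) \<in> carrier F" by (simp add: edge_word_def)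
  show "weight (edge_word (c, i)) = 0" by (simp add: edge_word_def weight_mult weight_inv)
qed

lemma path_in_lists:
  assumes "c \<in> weight ` carrier F" "w \<in> lists ({1..n} \<times> UNIV)"
  shows "path c w \<in> lists ((weight ` carrier F \<times> {1..n}) \<times> UNIV)"
  using assms
proof (induction c w rule: path.induct)
  case (2 c i b w)
  then show ?case using weight_image_step[of c i] by auto
qed simp

lemma D_subset: "D \<subseteq> carrier F"
  by (rule F.derived_in_carrier) simp

lemma edge_word_funcset: "edge_word \<in> weight ` carrier F \<times> {1..n} \<rightarrow> D"
  using edge_word_in_derived by auto

text \<open>Carrying the representative past each letter emits one edge word, and the intermediate
  representatives telescope.\<close>

lemma transversal_mult_eval_word:
  assumes "c \<in> weight ` carrier F" "w \<in> lists ({1..n} \<times> UNIV)"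
  shows "transversal c \<otimes>\<^bsub>F\<^esub> eval_word F free_gen w =
    eval_word F edge_word (path c w) \<otimes>\<^bsub>F\<^esub> transversal (c + weight w)"
  using assms
proof (induction c w rule: path.induct)
  case (1 c)
  then show ?case using transversal[of c] by simp
next
  case (2 c i b w)
  let ?c = "if b then c + t i else c - t i"
  let ?l = "if b then ((c, i), True) else ((c - t i, i), False)"
  have i: "i \<in> {1..n}" and w: "w \<in> lists ({1..n} \<times> UNIV)" using 2 by auto
  note c = weight_image_step[OF 2(3) i]
  have c': "?c \<in> weight ` carrier F" using c by simp
  have e: "edge_word \<in> weight ` carrier F \<times> {1..n} \<rightarrow> carrier F"
    using edge_word_funcset D_subset by auto
  have cl: "transversal c \<in> carrier F" "transversal ?c \<in> carrier F"
    "transversal (c + weight ((i, b) # w)) \<in> carrier F"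
    using transversal(1) 2(3) c' weight_image_add[OF 2(3,4)] by blast+
  have g: "free_gen \<in> {1..n} \<rightarrow> carrier F" by (auto intro: free_gen_closed)
  have cl': "free_gen i \<in> carrier F" "eval_word F free_gen w \<in> carrier F"
    "eval_letter F free_gen (i, b) \<in> carrier F"
    using g i eval_word_closed[OF group_free_group g w]
      eval_letter_closed[OF group_free_group g, of "(i, b)"] by auto
  have "?l \<in> (weight ` carrier F \<times> {1..n}) \<times> UNIV" using i c 2(3) by auto
  note cl = cl cl' eval_letter_closed[OF group_free_group e this]
    eval_word_closed[OF group_free_group e path_in_lists[OF c' w]]
  \<comment> \<open>An inverse letter runs backwards along the edge that starts at
    \<open>c - t i\<close>, hence contributes the inverse of that edge word.\<close>
  have step: "transversal c \<otimes>\<^bsub>F\<^esub> eval_letter F free_gen (i, b) =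
      eval_letter F edge_word ?l \<otimes>\<^bsub>F\<^esub> transversal ?c"
    using cl transversal(1)[OF c(1)] transversal(1)[OF c(2)]
    by (auto simp: eval_letter_def edge_word_def F.inv_mult_group F.m_assoc)
  have "transversal c \<otimes>\<^bsub>F\<^esub> eval_word F free_gen ((i, b) # w) =
      transversal c \<otimes>\<^bsub>F\<^esub> eval_letter F free_gen (i, b) \<otimes>\<^bsub>F\<^esub> eval_word F free_gen w"
    using cl by (simp add: F.m_assoc)
  also have "\<dots> = eval_letter F edge_word ?l \<otimes>\<^bsub>F\<^esub> (transversal ?c \<otimes>\<^bsub>F\<^esub> eval_word F free_gen w)"
    unfolding step using cl by (simp add: F.m_assoc)
  also have "transversal ?c \<otimes>\<^bsub>F\<^esub> eval_word F free_gen w =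
      eval_word F edge_word (path ?c w) \<otimes>\<^bsub>F\<^esub> transversal (c + weight ((i, b) # w))"
    using 2(1,2) c w by (cases b) (simp_all add: algebra_simps)
  also have "eval_letter F edge_word ?l \<otimes>\<^bsub>F\<^esub> \<dots> = eval_word F edge_word (path c ((i, b) # w))
      \<otimes>\<^bsub>F\<^esub> transversal (c + weight ((i, b) # w))"
    using cl by (cases b) (simp_all add: F.m_assoc)
  finally show ?case .
qed

text \<open>This lets \<open>eval_word_in_derived\<close> be applied with \<open>D\<close> as the
  ambient group, giving membership in the second commutator subgroup.\<close>

lemma eval_word_subgroup:
  assumes "subgroup K F" "f \<in> A \<rightarrow> K" "w \<in> lists (A \<times> UNIV)"
  shows "eval_word (F\<lparr>carrier := K\<rparr>) f w = eval_word F f w"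
  using assms(3)
proof (induction w)
  case (Cons l w)
  then have "f (fst l) \<in> K" using assms(2) by auto
  then show ?case
    using Cons F.m_inv_consistent[OF assms(1)] by (auto simp: eval_letter_def)
qed simp

text \<open>
  A word with vanishing Fox derivatives traverses every edge of the Cayley graph as often forwards as
  backwards, so modulo the second commutator subgroup its edge words cancel.
\<close>

lemma kernel_mu: "w \<in> carrier F \<and> mu w = \<one>\<^bsub>magnus_group\<^esub> \<longleftrightarrow> w \<in> derived F D"
proof
  assume w: "w \<in> derived F D"
  have sub: "derived F D \<subseteq> carrier F" by (intro F.derived_in_carrier D_subset)
  have "mu ` derived F D = derived magnus_group (derived magnus_group (mu ` carrier F))"
    using mu.derived_img[of "carrier F"] mu.derived_img[OF D_subset] by simp
  also have "\<dots> \<subseteq> derived magnus_group (derived magnus_group (carrier magnus_group))"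
    by (intro H.mono_derived) simp
  also have "\<dots> \<subseteq> {\<one>\<^bsub>magnus_group\<^esub>}" by (rule derived_derived_magnus_group)
  finally show "w \<in> carrier F \<and> mu w = \<one>\<^bsub>magnus_group\<^esub>" using w sub by auto
next
  assume w: "w \<in> carrier F \<and> mu w = \<one>\<^bsub>magnus_group\<^esub>"
  then have w0: "weight w = 0" and fox: "fox w j = 0" for j
    by (simp_all add: weight_def fox_def)
  have wl: "w \<in> lists ({1..n} \<times> UNIV)" using w by (simp add: free_group_simps)
  have 0: "0 \<in> weight ` carrier F" by (rule image_eqI[of _ _ "[]"]) (simp_all add: free_group_simps)
  have D: "subgroup D F" by (rule F.derived_is_subgroup) simp
  interpret FD: group "F\<lparr>carrier := D\<rparr>" by (rule F.subgroup_imp_group[OF D])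
  let ?e = "eval_word F edge_word (path 0 w)"
  have e: "?e \<in> derived F D"
    using FD.eval_word_in_derived[OF _ path_in_lists[OF 0 wl], of edge_word]
      edge_word_funcset exponent_sum_path[OF fox] F.derived_consistent[OF _ D]
    by (simp add: eval_word_subgroup[OF D edge_word_funcset path_in_lists[OF 0 wl]])
  have "?e \<in> carrier F" using e F.derived_in_carrier[OF D_subset] by auto
  \<comment> \<open>Since \<open>w\<close> has weight 0, both end representatives are empty and the
    rewriting returns \<open>w\<close> itself.\<close>
  then have "?e = w"
    using transversal_mult_eval_word[OF 0 wl] w w0 F.r_one[of ?e] F.l_one[of w]
    by (simp add: transversal_def eval_word_free_group free_group_simps)
  with e show "w \<in> derived F D" by simp
qed

section \<open>Partial conjugations and fixed points\<close>

text \<open>Allowing any word \<open>u\<close> gives the inverse map, built from the inverse of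
  \<open>u\<close>, the same form.\<close>

definition partial_conj :: "nat \<Rightarrow> (nat \<times> bool) list \<Rightarrow> (nat \<times> bool) list \<Rightarrow> (nat \<times> bool) list" where
  "partial_conj i u =
     eval_word F (\<lambda>j. if j = i then u \<otimes>\<^bsub>F\<^esub> free_gen i \<otimes>\<^bsub>F\<^esub> inv\<^bsub>F\<^esub> u else free_gen j)"

lemma partial_conj_funcset:
  assumes "u \<in> carrier F"
  shows "(\<lambda>j. if j = i then u \<otimes>\<^bsub>F\<^esub> free_gen i \<otimes>\<^bsub>F\<^esub> inv\<^bsub>F\<^esub> u else free_gen j) \<in> {1..n} \<rightarrow> carrier F"
  using assms by (auto intro!: F.m_closed free_gen_closed)

lemma partial_conj_hom:
  assumes "u \<in> carrier F"
  shows "partial_conj i u \<in> hom F F"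
  unfolding partial_conj_def by (rule eval_word_hom[OF group_free_group partial_conj_funcset[OF assms]])

lemma partial_conj_free_gen:
  assumes "u \<in> carrier F" "j \<in> {1..n}"
  shows "partial_conj i u (free_gen j) =
    (if j = i then u \<otimes>\<^bsub>F\<^esub> free_gen i \<otimes>\<^bsub>F\<^esub> inv\<^bsub>F\<^esub> u else free_gen j)"
  unfolding partial_conj_def
  by (rule eval_word_free_gen[OF group_free_group partial_conj_funcset[OF assms(1)] assms(2)])

text \<open>The outer map fixes \<open>u\<close>, so on generator \<open>i\<close> the two
  conjugations cancel; homomorphisms that agree on the generators are equal.\<close>

lemma partial_conj_partial_conj_inv:
  assumes u: "u \<in> carrier F" "partial_conj i u u = u" and w: "w \<in> carrier F"
  shows "partial_conj i u (partial_conj i (inv\<^bsub>F\<^esub> u) w) = w"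
proof -
  interpret p: group_hom F F "partial_conj i u"
    by unfold_locales (rule partial_conj_hom[OF u(1)])
  have "partial_conj i u \<circ> partial_conj i (inv\<^bsub>F\<^esub> u) \<in> hom F F"
    using u by (intro hom_compose[of _ _ F] partial_conj_hom) auto
  moreover have cancel: "inv\<^bsub>F\<^esub> u \<otimes>\<^bsub>F\<^esub> (u \<otimes>\<^bsub>F\<^esub> x) = x" if "x \<in> carrier F" for x
    using u that by (simp add: F.m_assoc[symmetric])
  have "(partial_conj i u \<circ> partial_conj i (inv\<^bsub>F\<^esub> u)) (free_gen j) = free_gen j"
    if "j \<in> {1..n}" for j
    using u that free_gen_closed[OF that] by (auto simp: partial_conj_free_gen F.m_assoc cancel)
  ultimately have "(partial_conj i u \<circ> partial_conj i (inv\<^bsub>F\<^esub> u)) w = eval_word F free_gen w"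
    using w by (intro eval_word_unique[OF group_free_group, of free_gen "{1..n}"])
      (auto simp: comp_def intro: free_gen_closed)
  then show ?thesis using w by (simp add: eval_word_free_group)
qed

lemma bij_partial_conj:
  assumes "u \<in> carrier F" "partial_conj i u u = u" "partial_conj i (inv\<^bsub>F\<^esub> u) u = u"
  shows "bij_betw (partial_conj i u) (carrier F) (carrier F)"
proof (rule bij_betw_byWitness[where f' = "partial_conj i (inv\<^bsub>F\<^esub> u)"])
  interpret p: group_hom F F "partial_conj i (inv\<^bsub>F\<^esub> u)"
    by unfold_locales (rule partial_conj_hom[OF F.inv_closed[OF assms(1)]])
  show "\<forall>w\<in>carrier F. partial_conj i (inv\<^bsub>F\<^esub> u) (partial_conj i u w) = w"
    using partial_conj_partial_conj_inv[of "inv\<^bsub>F\<^esub> u" i] assms by simp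
  show "\<forall>w\<in>carrier F. partial_conj i u (partial_conj i (inv\<^bsub>F\<^esub> u) w) = w"
    using partial_conj_partial_conj_inv[of u i] assms by simp
  show "partial_conj i u ` carrier F \<subseteq> carrier F" "partial_conj i (inv\<^bsub>F\<^esub> u) ` carrier F \<subseteq> carrier F"
    using partial_conj_hom assms(1) by (auto simp: hom_def)
qed

text \<open>The chain rule for Fox derivatives: \<open>g_k g_i g_k^-1\<close> has derivative
  \<open>x_k\<close> in direction \<open>i\<close> and \<open>1 - x_i\<close> in direction
  \<open>k\<close>; subtracting the unit vector at \<open>i\<close> gives the correction.\<close>

lemma mu_partial_conj:
  assumes i: "i \<in> {1..n}" and k: "k \<in> {1..n}" "k \<noteq> i" and w: "w \<in> carrier F"
  shows "mu (partial_conj i (free_gen k) w) = (weight w,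
    \<lambda>j. fox w j + fox w i *
      ((if j = i then fps_exp (t k) - 1 else 0) + (if j = k then 1 - fps_exp (t i) else 0)))"
proof -
  let ?d = "\<lambda>j. (if j = i then fps_exp (t k) - 1 else 0) + (if j = k then 1 - fps_exp (t i) else 0)"
  \<comment> \<open>\<open>T\<close> is linear over power series in the vector part and preserves
    weights, hence is an endomorphism; comparing on generators then suffices.\<close>
  define T where "T x = (fst x, \<lambda>j. snd x j + snd x i * ?d j)" for x :: "real \<times> (nat \<Rightarrow> real fps)"
  let ?f = "\<lambda>j. T (mu (free_gen j))"
  have g: "free_gen j \<in> carrier F" if "j \<in> {1..n}" for j using that by (rule free_gen_closed)
  have e: "fps_exp (t k) * inverse (fps_exp (t k)) = 1"
    using fps_exp_add_mult[of "t k" "- t k"] by (simp add: fps_exp_neg)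
  have p: "partial_conj i (free_gen k) \<in> hom F F" by (intro partial_conj_hom g k)
  have "T \<in> hom magnus_group magnus_group"
    by (rule homI) (auto simp: T_def algebra_simps)
  then have "T \<circ> mu \<in> hom F magnus_group" by (intro hom_compose[OF mu_hom])
  then have 1: "(T \<circ> mu) w = eval_word magnus_group ?f w"
    using w by (intro eval_word_unique[OF group_magnus_group, of _ "{1..n}"]) (auto simp: comp_def)
  have "(mu \<circ> partial_conj i (free_gen k)) (free_gen j) = ?f j" if j: "j \<in> {1..n}" for j
  proof (cases "j = i")
    case True
    then show ?thesis
      using i k g[OF i] g[OF k(1)] unfolding comp_def partial_conj_free_gen[OF g[OF k(1)] j]
      by (auto simp: mu_eq T_def weight_mult weight_inv fox_mult fox_inv fps_exp_add_mult fun_eq_iff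
          algebra_simps fps_exp_neg e)
  next
    case False
    then show ?thesis
      unfolding comp_def partial_conj_free_gen[OF g[OF k(1)] j]
      by (simp add: mu_eq T_def fun_eq_iff)
  qed
  then have "(mu \<circ> partial_conj i (free_gen k)) w = eval_word magnus_group ?f w"
    using w by (intro eval_word_unique[OF group_magnus_group, of _ "{1..n}"] hom_compose[OF p mu_hom]) auto
  with 1 show ?thesis by (simp add: T_def mu_eq comp_def)
qed

definition cyc :: "nat \<Rightarrow> nat" where
  "cyc i = (if i = n then 1 else Suc i)"

fun cyclic_conj :: "nat list \<Rightarrow> (nat \<times> bool) list \<Rightarrow> (nat \<times> bool) list" where
  "cyclic_conj [] w = w"
| "cyclic_conj (i # xs) w = partial_conj i (free_gen (cyc i)) (cyclic_conj xs w)"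

end

section \<open>Lowest-order effect of products of partial conjugations\<close>

lemma fps_mult_nth_lowest:
  fixes f d :: "'a :: comm_ring_1 fps"
  assumes "\<And>m. m < k \<Longrightarrow> fps_nth f m = 0" "fps_nth d 0 = 0"
  shows "m \<le> k \<Longrightarrow> fps_nth (f * d) m = 0" "fps_nth (f * d) (Suc k) = fps_nth f k * fps_nth d 1"
proof -
  show "fps_nth (f * d) m = 0" if "m \<le> k"
  proof -
    have "fps_nth f i * fps_nth d (m - i) = 0" if "i \<le> m" for i
      using assms \<open>m \<le> k\<close> that by (cases "i < k") auto
    then show ?thesis by (simp add: fps_mult_nth)
  qed
  have "fps_nth f i * fps_nth d (Suc k - i) = (if i = k then fps_nth f k * fps_nth d 1 else 0)"
    if "i \<le> Suc k" for i
    using assms that by (cases i k rule: linorder_cases; cases "i = Suc k") (auto simp: One_nat_def)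
  then have "fps_nth (f * d) (Suc k) = (\<Sum>i=0..Suc k. if i = k then fps_nth f k * fps_nth d 1 else 0)"
    unfolding fps_mult_nth by (intro sum.cong) auto
  then show "fps_nth (f * d) (Suc k) = fps_nth f k * fps_nth d 1" by simp
qed

lemma (in magnus) cyclic_conj_facts:
  assumes n: "n \<ge> 2"
  shows "set xs \<subseteq> {1..n} \<Longrightarrow> cyclic_conj xs \<in> hom F F"
    and "set xs \<subseteq> {1..n} \<Longrightarrow> bij_betw (cyclic_conj xs) (carrier F) (carrier F)"
    and "set xs \<subseteq> {1..n} \<Longrightarrow> w \<in> carrier F \<Longrightarrow> weight (cyclic_conj xs w) = weight w"
proof -
  have cyc: "cyc i \<in> {1..n}" "cyc i \<noteq> i" if "i \<in> {1..n}" for i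
    using that n by (auto simp: cyc_def)
  have g: "free_gen (cyc i) \<in> carrier F" if "i \<in> {1..n}" for i
    using cyc[OF that] by (intro free_gen_closed)
  show hom: "cyclic_conj xs \<in> hom F F" if "set xs \<subseteq> {1..n}" for xs
    using that
  proof (induction xs)
    case Nil
    then show ?case by (auto simp: hom_def)
  next
    case (Cons i xs)
    then have "partial_conj i (free_gen (cyc i)) \<circ> cyclic_conj xs \<in> hom F F"
      using g by (intro hom_compose[of _ _ F] partial_conj_hom) auto
    then show ?case by (simp add: comp_def)
  qed
  show "bij_betw (cyclic_conj xs) (carrier F) (carrier F)" if "set xs \<subseteq> {1..n}"
    using that
  proof (induction xs)
    case Nil
    then show ?case by (simp add: bij_betw_def inj_on_def)
  next
    case (Cons i xs)
    then have i: "i \<in> {1..n}" by auto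
    \<comment> \<open>As \<open>cyc i\<close> differs from \<open>i\<close>, the conjugating
      generator is fixed both by this map and by its inverse.\<close>
    have "bij_betw (partial_conj i (free_gen (cyc i))) (carrier F) (carrier F)"
      using cyc[OF i] g[OF i] by (intro bij_partial_conj) (auto simp: partial_conj_free_gen)
    from bij_betw_trans[OF _ this, of "cyclic_conj xs" "carrier F"] Cons
    show ?case by (simp add: comp_def)
  qed
  show "weight (cyclic_conj xs w) = weight w" if "set xs \<subseteq> {1..n}" "w \<in> carrier F"
    using that
  proof (induction xs)
    case (Cons i xs)
    then have i: "i \<in> {1..n}" and w: "cyclic_conj xs w \<in> carrier F"
      using hom[of xs] by (auto simp: hom_def)
    have "mu (cyclic_conj (i # xs) w) = (weight (cyclic_conj xs w), fox (cyclic_conj (i # xs) w))"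
      using mu_partial_conj[OF i cyc[OF i] w] by (simp add: mu_eq)
    then show ?case using Cons by (simp add: mu_eq)
  qed simp
qed

text \<open>Each factor is the identity modulo the series variable. On a vector vanishing below
  order \<open>k\<close> the corrections therefore start at order \<open>k + 1\<close>, where they
  add up, all computed from the original coefficients of order \<open>k\<close>.\<close>

lemma (in magnus) fox_cyclic_conj:
  assumes n: "n \<ge> 2" and w: "w \<in> carrier F" and 0: "\<And>j m. m < k \<Longrightarrow> fps_nth (fox w j) m = 0"
    and xs: "set xs \<subseteq> {1..n}"
  shows "m \<le> k \<Longrightarrow> fps_nth (fox (cyclic_conj xs w) j) m = fps_nth (fox w j) m"
    and "fps_nth (fox (cyclic_conj xs w) j) (Suc k) = fps_nth (fox w j) (Suc k) +
      (\<Sum>i\<leftarrow>xs. fps_nth (fox w i) k * ((if j = i then t (cyc i) else 0) - (if j = cyc i then t i else 0)))"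
proof -
  let ?c = "\<lambda>i j. (if j = i then t (cyc i) else 0) - (if j = cyc i then t i else 0)"
  have "(\<forall>j. \<forall>m\<le>k. fps_nth (fox (cyclic_conj xs w) j) m = fps_nth (fox w j) m) \<and>
    (\<forall>j. fps_nth (fox (cyclic_conj xs w) j) (Suc k) =
       fps_nth (fox w j) (Suc k) + (\<Sum>i\<leftarrow>xs. fps_nth (fox w i) k * ?c i j))"
    using xs
  proof (induction xs)
    case (Cons i xs)
    let ?u = "cyclic_conj xs w"
    let ?d = "\<lambda>j. (if j = i then fps_exp (t (cyc i)) - 1 else 0) + (if j = cyc i then 1 - fps_exp (t i) else 0)"
    have i: "i \<in> {1..n}" "cyc i \<in> {1..n}" "cyc i \<noteq> i" and xs: "set xs \<subseteq> {1..n}"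
      using Cons.prems n by (auto simp: cyc_def)
    have IH1: "fps_nth (fox ?u j) m = fps_nth (fox w j) m" if "m \<le> k" for j m
      using Cons.IH[OF xs] that by blast
    have IH2: "fps_nth (fox ?u j) (Suc k) =
       fps_nth (fox w j) (Suc k) + (\<Sum>i\<leftarrow>xs. fps_nth (fox w i) k * ?c i j)" for j
      using Cons.IH[OF xs] by blast
    have "?u \<in> carrier F" using cyclic_conj_facts(1)[OF n xs] w by (auto simp: hom_def)
    from mu_partial_conj[OF i this]
    have fox: "fox (cyclic_conj (i # xs) w) j = fox ?u j + fox ?u i * ?d j" for j
      by (simp add: mu_eq)
    have low: "fps_nth (fox ?u i) m = 0" if "m < k" for m
      using IH1[of m i] 0 that by simp
    have d: "fps_nth (?d j) 0 = 0" "fps_nth (?d j) 1 = ?c i j" for j by simp_all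
    have product: "m \<le> k \<Longrightarrow> fps_nth (fox ?u i * ?d j) m = 0"
      "fps_nth (fox ?u i * ?d j) (Suc k) = fps_nth (fox ?u i) k * fps_nth (?d j) 1" for j m
      using fps_mult_nth_lowest[of k "fox ?u i" "?d j"] low d(1) by blast+
    have "fps_nth (fox (cyclic_conj (i # xs) w) j) m = fps_nth (fox w j) m" if "m \<le> k" for j m
      unfolding fox fps_add_nth product(1)[OF that] using IH1[OF that] by simp
    moreover have "fps_nth (fox (cyclic_conj (i # xs) w) j) (Suc k) =
       fps_nth (fox w j) (Suc k) + (\<Sum>i\<leftarrow>i # xs. fps_nth (fox w i) k * ?c i j)" for j
      unfolding fox fps_add_nth product(2) d(2) IH2 IH1[OF order_refl] by simp
    ultimately show ?case by blast
  qed simp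
  then show "m \<le> k \<Longrightarrow> fps_nth (fox (cyclic_conj xs w) j) m = fps_nth (fox w j) m"
    and "fps_nth (fox (cyclic_conj xs w) j) (Suc k) =
       fps_nth (fox w j) (Suc k) + (\<Sum>i\<leftarrow>xs. fps_nth (fox w i) k * ?c i j)"
    by blast+
qed

text \<open>Taking direct images of cosets avoids a choice of representatives, and invariance of
  \<open>K\<close> makes the images cosets again. The restriction is there because
  \<open>auto\<close> admits only extensional maps.\<close>

lemma (in group) auto_FactGroup:
  assumes K: "K \<lhd> G" and f: "f \<in> hom G G" "bij_betw f (carrier G) (carrier G)" "f ` K = K"
  defines "\<alpha> \<equiv> restrict ((`) f) (carrier (G Mod K))"
  shows "\<alpha> \<in> auto (G Mod K)" "\<And>x. x \<in> carrier G \<Longrightarrow> \<alpha> (K #> x) = K #> f x"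
proof -
  interpret K: normal K G by (rule K)
  have fc: "f x \<in> carrier G" if "x \<in> carrier G" for x using f(1) that by (auto simp: hom_def)
  have fm: "f (x \<otimes> y) = f x \<otimes> f y" if "x \<in> carrier G" "y \<in> carrier G" for x y
    using f(1) that by (auto simp: hom_def)
  have img: "f ` (K #> x) = K #> f x" if x: "x \<in> carrier G" for x
  proof -
    have "f ` (K #> x) = (\<lambda>k. f k \<otimes> f x) ` K"
      using K.subset x by (auto simp: r_coset_def fm subset_iff image_iff intro!: bexI)
    also have "\<dots> = f ` K #> f x" by (auto simp: r_coset_def)
    finally show ?thesis by (simp add: f(3))
  qed
  have carr: "carrier (G Mod K) = (\<lambda>x. K #> x) ` carrier G"
    by (auto simp: FactGroup_def RCOSETS_def)
  show \<alpha>: "\<alpha> (K #> x) = K #> f x" if "x \<in> carrier G" for x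
    using that by (simp add: \<alpha>_def carr img)
  have "\<alpha> \<in> hom (G Mod K) (G Mod K)"
  proof (rule homI)
    fix A B assume "A \<in> carrier (G Mod K)" "B \<in> carrier (G Mod K)"
    then show "\<alpha> (A \<otimes>\<^bsub>G Mod K\<^esub> B) = \<alpha> A \<otimes>\<^bsub>G Mod K\<^esub> \<alpha> B"
      by (auto simp: carr K.rcos_sum \<alpha> fc fm)
  qed (auto simp: carr \<alpha> fc)
  moreover have "inj_on \<alpha> (carrier (G Mod K))"
  proof (rule inj_onI)
    fix A B assume A: "A \<in> carrier (G Mod K)" and B: "B \<in> carrier (G Mod K)" and eq: "\<alpha> A = \<alpha> B"
    have "A \<subseteq> carrier G" "B \<subseteq> carrier G"
      using A B r_coset_subset_G[OF K.subset] unfolding carr by blast+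
    then show "A = B"
      using eq A B inj_on_image_eq_iff[of f "carrier G" A B] f(2) by (auto simp: \<alpha>_def bij_betw_def)
  qed
  moreover have "\<alpha> ` carrier (G Mod K) = carrier (G Mod K)"
  proof -
    have "\<alpha> ` carrier (G Mod K) = (\<lambda>x. K #> x) ` f ` carrier G"
      unfolding carr image_image by (intro image_cong refl \<alpha>)
    also have "f ` carrier G = carrier G" using f(2) by (simp add: bij_betw_def)
    finally show ?thesis by (simp add: carr)
  qed
  ultimately show "\<alpha> \<in> auto (G Mod K)"
    by (simp add: auto_def Bij_def bij_betw_def) (simp add: \<alpha>_def)
qed

section \<open>Vectors fixed by the cyclic product\<close>

context magnus
begin

lemma fox_outside:
  "w \<in> lists ({1..n} \<times> UNIV) \<Longrightarrow> j \<notin> {1..n} \<Longrightarrow> fox w j = 0"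
proof (induction w)
  case (Cons l w)
  obtain i b where l: "l = (i, b)" by fastforce
  show ?case using Cons by (cases b) (auto simp: l)
qed simp

definition theta :: "(nat \<times> bool) list \<Rightarrow> (nat \<times> bool) list" where
  "theta = cyclic_conj [1..<Suc n]"

text \<open>At order \<open>k + 1\<close>, component \<open>i + 1\<close> of the fixed-point
  equation reads \<open>v_(i+1) t_(i+2) = v_i t_i\<close> with cyclic indices; multiplying by
  \<open>t_(i+1)\<close> shows that consecutive products coincide.\<close>

lemma theta_fixed_leading_coeffs:
  assumes n: "n \<ge> 2" and w: "w \<in> carrier F" and fixed: "mu (theta w) = mu w"
    and 0: "\<And>j m. m < k \<Longrightarrow> fps_nth (fox w j) m = 0"
  shows "\<exists>q. \<forall>i\<in>{1..n}. fps_nth (fox w i) k * (t i * t (cyc i)) = q"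
proof (intro exI ballI)
  let ?v = "\<lambda>i. fps_nth (fox w i) k"
  let ?q = "\<lambda>i. ?v i * (t i * t (cyc i))"
  have "fox (theta w) = fox w" using fixed by (simp add: mu_eq)
  then have sum: "(\<Sum>i\<leftarrow>[1..<Suc n]. ?v i * ((if j = i then t (cyc i) else 0) - (if j = cyc i then t i else 0))) = 0"
    for j
    using fox_cyclic_conj(2)[OF n w 0, of k "[1..<Suc n]" j] \<open>fox (theta w) = fox w\<close>
    by (simp add: theta_def[symmetric] subset_iff del: upt_Suc)
  have step: "?q (Suc i) = ?q i" if i: "1 \<le> i" "i < n" for i
  proof -
    have "(\<Sum>j\<leftarrow>[1..<Suc n]. ?v j * ((if Suc i = j then t (cyc j) else 0) - (if Suc i = cyc j then t j else 0))) =
      (\<Sum>j=1..n. ?v j * ((if Suc i = j then t (cyc j) else 0) - (if Suc i = cyc j then t j else 0)))"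
      by (subst sum_list_distinct_conv_sum_set) (auto intro!: sum.cong)
    \<comment> \<open>As \<open>Suc i > 1\<close>, the wrap-around value \<open>cyc n = 1\<close> is
      excluded and \<open>j = i\<close> is the only index with \<open>cyc j = Suc i\<close>.\<close>
    also have "\<dots> = (\<Sum>j=1..n. (if Suc i = j then ?v (Suc i) * t (cyc (Suc i)) else 0) -
        (if i = j then ?v i * t i else 0))"
      using i by (intro sum.cong) (auto simp: cyc_def algebra_simps)
    also have "\<dots> = ?v (Suc i) * t (cyc (Suc i)) - ?v i * t i"
      using i by (simp add: sum_subtractf)
    finally have "?v (Suc i) * t (cyc (Suc i)) = ?v i * t i"
      using sum[of "Suc i"] by simp
    then show ?thesis using i by (simp add: cyc_def mult.assoc)
  qed
  show "?q i = ?q 1" if "i \<in> {1..n}" for i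
    using that
  proof (induction i)
    case (Suc i)
    then show ?case using step[of i] by (cases "i = 0") (auto simp: One_nat_def)
  qed simp
qed

lemma theta_fixed_weight:
  assumes n: "n \<ge> 3" and w: "w \<in> carrier F" and fixed: "mu (theta w) = mu w"
  shows "weight w = 0"
proof -
  let ?a = "\<lambda>i. exponent_sum i w"
  obtain q where q: "\<And>i. i \<in> {1..n} \<Longrightarrow> of_int (?a i) * (t i * t (cyc i)) = q"
    using theta_fixed_leading_coeffs[of w 0] n w fixed by (auto simp: fox_nth_0)
  have t: "t 1 > 0" "t 2 > 0" "t 3 > 0" using t_pos n by auto
  \<comment> \<open>Here \<open>n \<ge> 3\<close> matters: \<open>cyc 2\<close> is 3, whereas for
    \<open>n = 2\<close> it would be 1 and \<open>t 1\<close> would cancel as well.\<close>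
  have "of_int (?a 1) * (t 1 * t 2) = of_int (?a 2) * (t 2 * t 3)"
    using q[of 1] q[of 2] n by (simp add: cyc_def)
  then have "of_int (?a 1) * t 1 - of_int (?a 2) * t 3 = 0"
    using t by (simp add: field_simps)
  moreover have "(\<Sum>i=1..n. of_int (if i = 1 then ?a 1 else if i = 3 then - ?a 2 else 0) * t i)
     = (\<Sum>i=1..n. (if 1 = i then of_int (?a 1) * t 1 else 0) - (if 3 = i then of_int (?a 2) * t 3 else 0))"
    by (intro sum.cong) auto
  moreover have "\<dots> = of_int (?a 1) * t 1 - of_int (?a 2) * t 3"
    using n by (simp add: sum_subtractf)
  ultimately have "?a 1 = 0"
    using t_indep[of "\<lambda>i. if i = 1 then ?a 1 else if i = 3 then - ?a 2 else 0" 1] n by simp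
  then have "q = 0" using q[of 1] n by simp
  then have "?a i = 0" if "i \<in> {1..n}" for i
  proof -
    have "cyc i \<in> {1..n}" using that n by (auto simp: cyc_def)
    then show ?thesis using q[OF that] t_pos[OF that] t_pos[of "cyc i"] \<open>q = 0\<close> by auto
  qed
  then show ?thesis using weight_eq_sum[of w] w by (simp add: free_group_simps)
qed

lemma theta_fixed:
  assumes n: "n \<ge> 3" and w: "w \<in> carrier F" and fixed: "mu (theta w) = mu w"
  shows "mu w = \<one>\<^bsub>magnus_group\<^esub>"
proof -
  have wl: "w \<in> lists ({1..n} \<times> UNIV)" using w by (simp add: free_group_simps)
  have w0: "weight w = 0" by (rule theta_fixed_weight[OF assms])
  have cyc: "cyc i \<in> {1..n}" if "i \<in> {1..n}" for i using that n by (auto simp: cyc_def)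
  have "fps_nth (fox w j) k = 0" for j k
  \<comment> \<open>All components are treated at once: the vanishing of every lower order makes
    \<open>k\<close> the lowest order.\<close>
  proof (induction k arbitrary: j rule: less_induct)
    case (less k)
    have "\<exists>q. \<forall>i\<in>{1..n}. fps_nth (fox w i) k * (t i * t (cyc i)) = q"
      using theta_fixed_leading_coeffs[OF _ w fixed less] n by auto
    then obtain q where q: "\<And>i. i \<in> {1..n} \<Longrightarrow> fps_nth (fox w i) k * (t i * t (cyc i)) = q" by auto
    have v: "fps_nth (fox w i) k * t i = q / t (cyc i)" if "i \<in> {1..n}" for i
      using q[OF that] t_pos[OF cyc[OF that]] by (simp add: field_simps)
    \<comment> \<open>At weight 0 the right side of the fundamental formula is 0; as
      \<open>fps_exp (t i) - 1\<close> has no constant term, order \<open>k + 1\<close> sees only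
      coefficients of order \<open>k\<close>.\<close>
    have "0 = fps_nth (\<Sum>i=1..n. fox w i * (fps_exp (t i) - 1)) (Suc k)"
      using fox_fundamental[OF wl] w0 by simp
    also have "\<dots> = (\<Sum>i=1..n. fps_nth (fox w i) k * t i)"
      unfolding fps_sum_nth
      by (intro sum.cong refl, subst fps_mult_nth_lowest(2)) (auto simp: less)
    also have "\<dots> = q * (\<Sum>i=1..n. 1 / t (cyc i))"
      unfolding sum_distrib_left by (intro sum.cong refl) (simp add: v)
    finally have "q * (\<Sum>i=1..n. 1 / t (cyc i)) = 0" by simp
    moreover have "(\<Sum>i=1..n. 1 / t (cyc i)) > 0"
      using n t_pos cyc by (intro sum_pos) auto
    ultimately have "q = 0" by auto
    show ?case
    proof (cases "j \<in> {1..n}")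
      case True
      then show ?thesis using q[OF True] \<open>q = 0\<close> t_pos[OF True] t_pos[OF cyc[OF True]] by auto
    qed (simp add: fox_outside[OF wl])
  qed
  then have "fox w j = 0" for j by (simp add: fps_eq_iff)
  then show ?thesis using w0 by (simp add: mu_eq fun_eq_iff)
qed

end

section \<open>Choice of the parameters and descent to the free metabelian group\<close>

lemma magnus_exists: "\<exists>t. magnus n t"
proof -
  obtain p :: "nat \<Rightarrow> nat" where p: "inj p" "range p \<subseteq> {p. Factorial_Ring.prime p}"
    using infinite_countable_subset[OF primes_infinite] by auto
  have prime: "Factorial_Ring.prime (p i)" for i using p by auto
  have "magnus n (\<lambda>i. ln (real (p i)))"
  proof
    show "0 < ln (real (p i))" for i
      using prime_gt_1_nat[OF prime, of i] by simp
    show "a i = 0" if "(\<Sum>i=1..n. of_int (a i) * ln (real (p i))) = 0" "i \<in> {1..n}" for a :: "nat \<Rightarrow> int" and i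
      using that p prime by (intro ln_primes_independent[of "{1..n}" p a i]) (auto intro: inj_on_subset)
  qed
  then show ?thesis by blast
qed

theorem theorem3p6:
  fixes n :: nat
  assumes "n \<ge> 3"
  shows "\<exists>\<alpha> \<in> auto (free_metabelian_group n).
           trivial_on_abelianization (free_metabelian_group n) \<alpha> \<and>
           (\<forall>g \<in> carrier (free_metabelian_group n).
              \<alpha> g = g \<longrightarrow> g = \<one>\<^bsub>free_metabelian_group n\<^esub>)"
proof -
  obtain t where "magnus n t" using magnus_exists by auto
  then interpret magnus n t .
  let ?K = "derived F D"
  let ?M = "F Mod ?K"
  have M: "free_metabelian_group n = ?M"
    by (simp add: free_metabelian_group_def metabelian_quotient_def)
  interpret K: normal ?K F by (rule normal_derived_derived[OF group_free_group])
  interpret M: group ?M by (rule K.factorgroup_is_group)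
  interpret pi: group_hom F ?M "\<lambda>x. ?K #>\<^bsub>F\<^esub> x"
    by unfold_locales (rule K.r_coset_hom_Mod)
  have n2: "n \<ge> 2" and xs: "set [1..<Suc n] \<subseteq> {1..n}" using assms by auto
  interpret th: group_hom F F theta
    unfolding theta_def by unfold_locales (rule cyclic_conj_facts(1)[OF n2 xs])
  have bij: "bij_betw theta (carrier F) (carrier F)"
    unfolding theta_def by (rule cyclic_conj_facts(2)[OF n2 xs])
  \<comment> \<open>Homomorphisms commute with forming derived subgroups and \<open>theta\<close> is
    onto, so it preserves \<open>?K\<close>.\<close>
  have "theta ` ?K = derived F (derived F (theta ` carrier F))"
    using th.derived_img[of "carrier F"] th.derived_img[OF D_subset] by simp
  then have img: "theta ` ?K = ?K" using bij by (simp add: bij_betw_def)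
  define \<alpha> where "\<alpha> = restrict ((`) theta) (carrier ?M)"
  note \<alpha> = F.auto_FactGroup[OF K.normal_axioms th.homh bij img, folded \<alpha>_def]
  have carr: "carrier ?M = (\<lambda>x. ?K #>\<^bsub>F\<^esub> x) ` carrier F"
    by (auto simp: FactGroup_def RCOSETS_def)
  have DM: "derived ?M (carrier ?M) = (\<lambda>x. ?K #>\<^bsub>F\<^esub> x) ` D"
    using pi.derived_img[of "carrier F"] by (simp add: carr)
  have sub: "subgroup (derived ?M (carrier ?M)) ?M" by (rule M.derived_is_subgroup) simp
  have "derived ?M (carrier ?M) #>\<^bsub>?M\<^esub> \<alpha> g = derived ?M (carrier ?M) #>\<^bsub>?M\<^esub> g"
    if g: "g \<in> carrier ?M" for g
  proof -
    obtain w where w: "w \<in> carrier F" "g = ?K #>\<^bsub>F\<^esub> w" using g unfolding carr by auto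
    \<comment> \<open>Since \<open>theta\<close> preserves weights, it moves \<open>w\<close> only
      by an element of \<open>D\<close>.\<close>
    let ?d = "theta w \<otimes>\<^bsub>F\<^esub> inv\<^bsub>F\<^esub> w"
    have "weight ?d = 0"
      using w cyclic_conj_facts(3)[OF n2 xs w(1), folded theta_def] by (simp add: weight_mult weight_inv)
    then have d: "?d \<in> D" using w by (intro in_derived_if_weight_eq_0) auto
    have "\<alpha> g = ?K #>\<^bsub>F\<^esub> (?d \<otimes>\<^bsub>F\<^esub> w)"
      using w by (simp add: \<alpha>(2) F.m_assoc)
    also have "\<dots> = (?K #>\<^bsub>F\<^esub> ?d) \<otimes>\<^bsub>?M\<^esub> g"
      using w by (subst pi.hom_mult) auto
    finally have "\<alpha> g \<in> derived ?M (carrier ?M) #>\<^bsub>?M\<^esub> g"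
      using d unfolding DM r_coset_def by auto
    from M.repr_independence[OF this g sub] show ?thesis by simp
  qed
  moreover have "g = \<one>\<^bsub>?M\<^esub>" if g: "g \<in> carrier ?M" "\<alpha> g = g" for g
  proof -
    obtain w where w: "w \<in> carrier F" "g = ?K #>\<^bsub>F\<^esub> w" using g unfolding carr by auto
    have "?K #>\<^bsub>F\<^esub> theta w = ?K #>\<^bsub>F\<^esub> w" using \<alpha>(2)[OF w(1)] g w by simp
    then have "theta w \<in> ?K #>\<^bsub>F\<^esub> w"
      using F.rcos_self[OF _ K.subgroup_axioms, of "theta w"] w by auto
    then obtain h where h: "h \<in> ?K" "theta w = h \<otimes>\<^bsub>F\<^esub> w" by (auto simp: r_coset_def)
    \<comment> \<open>A fixed coset gives \<open>theta w\<close> only up to a factor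
      \<open>h\<close> in the kernel of \<open>mu\<close>; hence the fixed-point lemmas assume
      equality of \<open>mu\<close> values instead of words.\<close>
    have hF: "h \<in> carrier F" and h1: "mu h = \<one>\<^bsub>magnus_group\<^esub>" using kernel_mu[of h] h by auto
    have "mu (theta w) = mu w" using mu.hom_mult[OF hF w(1)] h h1 by (simp add: mu_eq)
    then have "w \<in> ?K" using theta_fixed[OF assms w(1)] w kernel_mu[of w] by simp
    then show ?thesis using w K.rcos_const by simp
  qed
  ultimately show ?thesis
    unfolding M trivial_on_abelianization_def using \<alpha>(1) by blast
qed

end
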